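(* Let $n\ge1$ and let $S\subseteq V(G_n)$ be nonempty. For every vertex $\lambda\in V(G_n)$, there exists an $S$-monotone inward path from $\lambda$ to $S$ (i.e. starting at $\lambda$ and ending at a vertex of $S$) of length $d_S(\lambda)$. Equivalently, every vertex admits an $S$-monotone inward geodesic to $S$.
   Context: Partition graph: for $n\ge 1$, the vertices of the simple graph $G_n$ are the partitions $\lambda=(\lambda_1\ge\dots\ge\lambda_k>0)$ of $n$. An elementary unit transfer on $\lambda=(\lambda_1,\dots,\lambda_k)$: choose distinct indices $i,j\in\{1,\dots,k\}$, replace $\lambda_i$ by $\lambda_i+1$ and $\lambda_j$ by $\lambda_j-1$, delete the latter if it becomes $0$, and reorder the parts into nonincreasing form; if the resulting partition $\mu$ satisfies $\mu\neq\lambda$, then $\mu$ is obtained from $\lambda$ by an elementary unit transfer. Two partitions $\lambda,\mu$ of $n$ are adjacent in $G_n$ if one of them is obtained from the other by a single elementary unit transfer. The graph $G_n$ is connected. For nonempty $S\subseteq V(G_n)$, $d_S(\lambda)=\min_{\sigma\in S}d_{G_n}(\lambda,\sigma)$, where $d_{G_n}$ is the graph distance. A path $(\lambda_0,\dots,\lambda_m)$ in $G_n$ (consecutive vertices adjacent; length $m\ge 0$) is $S$-monotone inward if $d_S(\lambda_{i+1})=d_S(\lambda_i)-1$ for all $0\le i<m$. A geodesic from $\lambda$ to $S$ is a path from $\lambda$ to a vertex of $S$ whose length is $d_S(\lambda)$, the minimum possible. *)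

theory Defs
  imports "Graph_Theory.Graph_Theory"
begin

definition partitions :: "nat \<Rightarrow> nat list set" where
  "partitions n = {l. sorted_wrt (\<ge>) l \<and> (\<forall>x\<in>set l. 0 < x) \<and> sum_list l = n}"

text \<open>Parts are positive, so the subtraction on \<^typ>\<open>nat\<close> below does not truncate.
  Indices start at 0.\<close>

definition unit_transfer :: "nat list \<Rightarrow> nat \<Rightarrow> nat \<Rightarrow> nat list" where
  "unit_transfer l i j = rev (sort (filter (\<lambda>x. 0 < x) (l[i := l ! i + 1, j := l ! j - 1])))"

definition obtained_by_transfer :: "nat list \<Rightarrow> nat list \<Rightarrow> bool" where
  "obtained_by_transfer l m \<longleftrightarrow>
     (\<exists>i < length l. \<exists>j < length l. i \<noteq> j \<and> m = unit_transfer l i j \<and> m \<noteq> l)"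

definition partition_graph :: "nat \<Rightarrow> nat list pair_pre_digraph" where
  "partition_graph n =
     \<lparr> pverts = partitions n,
       parcs = {(l, m). l \<in> partitions n \<and> m \<in> partitions n \<and>
                  (obtained_by_transfer l m \<or> obtained_by_transfer m l)} \<rparr>"

text \<open>The graph distance is the library's weighted shortest-path distance with all arcs of
  weight 1. It takes values in \<^typ>\<open>ereal\<close>; all values are finite
  by \<open>connected_partition_graph\<close> below.\<close>

definition partition_dist :: "nat \<Rightarrow> nat list \<Rightarrow> nat list \<Rightarrow> ereal" where
  "partition_dist n l m = wf_digraph.\<mu> (with_proj (partition_graph n)) (\<lambda>_. 1) l m"

definition set_dist :: "nat \<Rightarrow> nat list set \<Rightarrow> nat list \<Rightarrow> ereal" where
  "set_dist n S l = Min ((\<lambda>s. partition_dist n l s) ` S)"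

text \<open>A path is only required to have adjacent consecutive vertices, hence \<^const>\<open>vwalk\<close>
  rather than \<^const>\<open>vpath\<close>, which in addition excludes repeated vertices.\<close>

definition path_to :: "nat \<Rightarrow> nat list set \<Rightarrow> nat list \<Rightarrow> nat list list \<Rightarrow> bool" where
  "path_to n S l p \<longleftrightarrow> vwalk p (with_proj (partition_graph n)) \<and> hd p = l \<and> last p \<in> S"

definition monotone_inward :: "nat \<Rightarrow> nat list set \<Rightarrow> nat list list \<Rightarrow> bool" where
  "monotone_inward n S p \<longleftrightarrow>
     vwalk p (with_proj (partition_graph n)) \<and>
     (\<forall>i < vwalk_length p. set_dist n S (p ! Suc i) = set_dist n S (p ! i) - 1)"

definition geodesic_to :: "nat \<Rightarrow> nat list set \<Rightarrow> nat list \<Rightarrow> nat list list \<Rightarrow> bool" where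
  "geodesic_to n S l p \<longleftrightarrow>
     path_to n S l p \<and> ereal (real (vwalk_length p)) = set_dist n S l \<and>
     (\<forall>q. path_to n S l q \<longrightarrow> vwalk_length p \<le> vwalk_length q)"

lemma finite_partitions: "finite (partitions n)"
proof -
  have "partitions n \<subseteq> {xs. set xs \<subseteq> {..n} \<and> length xs \<le> n}"
  proof
    fix l assume l: "l \<in> partitions n"
    have "length xs \<le> sum_list xs" if "\<forall>x\<in>set xs. 0 < x" for xs :: "nat list"
      using that by (induction xs) auto
    then show "l \<in> {xs. set xs \<subseteq> {..n} \<and> length xs \<le> n}"
      using l member_le_sum_list by (fastforce simp: partitions_def)
  qed
  then show ?thesis
    using finite_lists_length_le[of "{..n}" n] finite_subset by blast
qed

lemma pair_graph_partition_graph: "pair_graph (partition_graph n)"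
proof -
  have "parcs (partition_graph n) \<subseteq> partitions n \<times> partitions n"
    by (auto simp: partition_graph_def)
  then have fin: "finite (parcs (partition_graph n))"
    using finite_partitions finite_subset by blast
  have "sym (parcs (partition_graph n))"
    by (rule symI) (auto simp: partition_graph_def)
  then have sym: "symmetric (with_proj (partition_graph n))"
    by (simp add: symmetric_def)
  show ?thesis
    by unfold_locales
      (use fin sym in \<open>auto simp: partition_graph_def obtained_by_transfer_def finite_partitions\<close>)
qed

lemma sum_list_filter_pos:
  fixes f :: "nat \<Rightarrow> nat"
  assumes "f 0 = 0"
  shows "sum_list (map f (filter (\<lambda>x. 0 < x) xs)) = sum_list (map f xs)"
  using assms by (induction xs) auto

lemma sum_list_unit_transfer:
  fixes f :: "nat \<Rightarrow> nat"
  assumes "f 0 = 0" "i < length l" "j < length l" "i \<noteq> j"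
  shows "sum_list (map f (unit_transfer l i j)) + f (l ! i) + f (l ! j) =
         sum_list (map f l) + f (l ! i + 1) + f (l ! j - 1)"
proof -
  have upd: "sum_list (map f (xs[k := x])) + f (xs ! k) = sum_list (map f xs) + f x"
    if "k < length xs" for xs :: "nat list" and k x
    using that by (induction xs arbitrary: k) (auto split: nat.splits)
  have "mset (map f (unit_transfer l i j)) =
        mset (map f (filter (\<lambda>x. 0 < x) (l[i := l ! i + 1, j := l ! j - 1])))"
    by (simp add: unit_transfer_def)
  then have "sum_list (map f (unit_transfer l i j)) =
      sum_list (map f (filter (\<lambda>x. 0 < x) (l[i := l ! i + 1, j := l ! j - 1])))"
    by (metis sum_mset_sum_list)
  also have "\<dots> = sum_list (map f (l[i := l ! i + 1, j := l ! j - 1]))"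
    by (rule sum_list_filter_pos[of f, OF assms(1)])
  finally show ?thesis
    using upd[of i l "l ! i + 1"] upd[of j "l[i := l ! i + 1]" "l ! j - 1"] assms
    by simp
qed

lemma unit_transfer_in_partitions:
  assumes "l \<in> partitions n" "i < length l" "j < length l" "i \<noteq> j"
  shows "unit_transfer l i j \<in> partitions n"
proof -
  have "0 < l ! j"
    using assms by (auto simp: partitions_def)
  then have "sum_list (unit_transfer l i j) = sum_list l"
    using sum_list_unit_transfer[of "\<lambda>x. x" i l j] assms by simp
  moreover have "sorted_wrt (\<ge>) (unit_transfer l i j)"
    by (simp add: unit_transfer_def sorted_wrt_rev)
  moreover have "\<forall>x\<in>set (unit_transfer l i j). 0 < x"
    by (simp add: unit_transfer_def)
  ultimately show ?thesis
    using assms by (simp add: partitions_def)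
qed

lemma connected_partition_graph: "strongly_connected (with_proj (partition_graph n))"
proof -
  let ?G = "with_proj (partition_graph n)"
  let ?sq = "\<lambda>l. sum_list (map (\<lambda>x. x * x) l) :: nat"
  define t where "t = (if n = 0 then [] else [n])"
  interpret pair_graph "partition_graph n"
    by (rule pair_graph_partition_graph)
  have sq_le: "?sq l \<le> sum_list l * sum_list l" for l :: "nat list"
    by (induction l) (auto simp: algebra_simps)
  have reach: "l \<rightarrow>\<^sup>*\<^bsub>?G\<^esub> t" if "l \<in> partitions n" for l
    using that
  proof (induction "n * n - ?sq l" arbitrary: l rule: less_induct)
    case less
    show ?case
    proof (cases "length l \<le> 1")
      case True
      then have "l = t"
        using less.prems by (cases l) (auto simp: partitions_def t_def)
      then show ?thesis
        using less.prems reachable_refl[of l] by (simp add: partition_graph_def)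
    next
      case False
      define j where "j = length l - 1"
      define m where "m = unit_transfer l 0 j"
      have j: "0 < j" "j < length l" "0 < length l"
        using False by (auto simp: j_def)
      have m: "m \<in> partitions n"
        using unit_transfer_in_partitions less.prems j by (simp add: m_def)
      have le: "l ! j \<le> l ! 0"
        using less.prems j sorted_wrt_nth_less[of "(\<ge>)" l 0 j] by (simp add: partitions_def)
      obtain b where b: "l ! j = Suc b"
        using less.prems j by (metis (no_types, lifting) partitions_def mem_Collect_eq
            nth_mem gr0_implies_Suc)
      have "?sq l < ?sq m"
        using sum_list_unit_transfer[of "\<lambda>x. x * x" 0 l j] j le b by (simp add: m_def)
      then have "m \<noteq> l" "n * n - ?sq m < n * n - ?sq l"
        using sq_le[of m] m by (auto simp: partitions_def)
      then have "m \<rightarrow>\<^sup>*\<^bsub>?G\<^esub> t" "(l, m) \<in> parcs (partition_graph n)"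
        using less m j by (auto simp: partition_graph_def obtained_by_transfer_def m_def)
      then show ?thesis
        by (intro adj_reachable_trans[of l m t]) simp_all
    qed
  qed
  have "t \<in> partitions n"
    by (auto simp: t_def partitions_def)
  then have "verts ?G \<noteq> {}"
    by (auto simp: partition_graph_def)
  moreover have "u \<rightarrow>\<^sup>*\<^bsub>?G\<^esub> v" if "u \<in> verts ?G" "v \<in> verts ?G" for u v
  proof -
    have "u \<rightarrow>\<^sup>*\<^bsub>?G\<^esub> t" "v \<rightarrow>\<^sup>*\<^bsub>?G\<^esub> t"
      using that reach by (simp_all add: partition_graph_def)
    then show ?thesis
      using symmetric_reachable[OF pair_sym_arcs] reachable_trans by blast
  qed
  ultimately show ?thesis
    by (rule strongly_connectedI)
qed

end

theory Submission
  imports Defs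
begin

text \<open>
  Every shortest walk to \<open>S\<close> is automatically monotone inward, and shortest walks to \<open>S\<close> exist
  because the partition graph is finite and connected.

  For the monotonicity, let \<open>p\<close> be a shortest walk from \<open>l\<close> to \<open>S\<close>, with \<open>m = d_S(l)\<close> steps. The
  tail of \<open>p\<close> from its \<open>i\<close>-th vertex on shows that this vertex has distance at most \<open>m - i\<close> from
  \<open>S\<close>. The distance cannot be smaller, since the first \<open>i\<close> steps of \<open>p\<close> followed by a shortest
  walk from that vertex to \<open>S\<close> form a walk from \<open>l\<close> to \<open>S\<close>, which has at least \<open>m\<close> steps. So
  the distance is exactly \<open>m - i\<close> (lemma \<open>set_dist_along_shortest\<close>), and it drops by one
  at each step.

  The distance in the definitions is an infimum of costs of arc walks, whereas the paths of the
  theorem are lists of vertices. The lemmas \<open>set_dist_le\<close> and \<open>shortest_path_exists\<close> translate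
  between the two: together they say that \<open>d_S(l)\<close> is the minimum, and not just a lower bound, of
  the lengths of vertex walks from \<open>l\<close> to \<open>S\<close>.
\<close>

context pair_wf_digraph
begin

lemma vwalk_imp_awalk:
  assumes "vwalk p (with_proj G)"
  shows "awalk (hd p) (vwalk_arcs p) (last p)"
  using assms
proof (induction rule: vwalk_induct)
  case (Base u)
  then show ?case by (simp add: awalk_Nil_iff)
next
  case (Cons u v es)
  then show ?case by (simp add: awalk_Cons_iff)
qed

lemma awalk_cost_1: "awalk_cost (\<lambda>_. 1) p = real (length p)"
  by (induction p) auto

end

lemma set_dist_le:
  assumes "S \<subseteq> partitions n" "path_to n S l p"
  shows "set_dist n S l \<le> ereal (real (vwalk_length p))"
proof -
  interpret pair_graph "partition_graph n"
    by (rule pair_graph_partition_graph)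
  have p: "vwalk p (with_proj (partition_graph n))" "hd p = l" "last p \<in> S"
    using assms by (auto simp: path_to_def)
  have "finite S"
    using assms finite_partitions finite_subset by blast
  then have "set_dist n S l \<le> partition_dist n l (last p)"
    using p by (simp add: set_dist_def)
  also have "\<dots> \<le> ereal (real (vwalk_length p))"
    using min_cost_le_walk_cost[OF vwalk_imp_awalk[OF p(1)], of "\<lambda>_. 1"] p(2)
    by (simp add: partition_dist_def awalk_cost_1 flip: vwalk_length_def del: vwalk_length_simp)
  finally show ?thesis .
qed

text \<open>Connectedness gives some walk to each vertex of \<open>S\<close>. Both minima are then attained: the one over \<open>S\<close>
  because \<open>S\<close> is finite, and the one over walks because with nonnegative weights it suffices to consider
  walks without repeated vertices, of which a finite graph has finitely many.\<close>

lemma shortest_path_exists: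
  assumes "S \<subseteq> partitions n" "S \<noteq> {}" "l \<in> partitions n"
  obtains p where "path_to n S l p" "set_dist n S l = ereal (real (vwalk_length p))"
proof -
  interpret pair_graph "partition_graph n"
    by (rule pair_graph_partition_graph)
  have "finite S"
    using assms finite_partitions finite_subset by blast
  then have "set_dist n S l \<in> partition_dist n l ` S"
    unfolding set_dist_def using assms by (intro Min_in) auto
  then obtain s where s: "s \<in> S" "set_dist n S l = partition_dist n l s"
    by auto
  have "l \<rightarrow>\<^sup>*\<^bsub>with_proj (partition_graph n)\<^esub> s"
    using connected_partition_graph[of n] assms s
    by (auto simp: strongly_connected_def partition_graph_def)
  then obtain es where es: "apath l es s" "partition_dist n l s = awalk_cost (\<lambda>_. 1) es"
    unfolding partition_dist_def using min_cost_awalk[of l s "\<lambda>_. 1"] by auto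
  have walk: "awalk l es s"
    using es awalkI_apath by blast
  let ?p = "pawalk_verts l es"
  have "vwalk ?p (with_proj (partition_graph n))"
    using awalk_imp_vwalk[OF walk] .
  moreover have "hd ?p = l" "last ?p = s"
    using awhd_of_awalk[OF walk] awlast_of_awalk[OF walk] by (auto simp: NOMATCH_def)
  moreover have "length ?p = Suc (length es)"
    by (rule length_awalk_verts)
  ultimately show thesis
    using that[of ?p] s es by (simp add: path_to_def awalk_cost_1)
qed

lemma set_dist_along_shortest:
  assumes S: "S \<subseteq> partitions n" "S \<noteq> {}"
    and p: "path_to n S l p" "set_dist n S l = ereal (real (vwalk_length p))"
    and i: "i < length p"
  shows "set_dist n S (p ! i) = ereal (real (vwalk_length p) - real i)"
proof (rule antisym)
  let ?G = "with_proj (partition_graph n)"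
  have walk: "vwalk p ?G" "hd p = l" "last p \<in> S"
    using p by (auto simp: path_to_def)
  \<comment> \<open>The rest of \<open>p\<close> bounds the distance from above.\<close>
  have "path_to n S (p ! i) (drop i p)"
    using walk i vwalkI_append_r[of "drop i p" "take i p" ?G]
    by (simp add: path_to_def hd_drop_conv_nth)
  from set_dist_le[OF S(1) this]
  show "set_dist n S (p ! i) \<le> ereal (real (vwalk_length p) - real i)"
    using i by (simp add: of_nat_diff algebra_simps)

  \<comment> \<open>A shorter way \<open>q\<close> from \<open>p ! i\<close> to \<open>S\<close> would make the detour \<open>take (Suc i) p \<oplus> q\<close> shorter than
    \<open>p\<close>; the prefix has \<open>Suc i\<close> vertices so that it ends in \<open>p ! i\<close>, where \<open>q\<close> starts.\<close>
  have "p ! i \<in> partitions n"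
    using walk(1) i by (auto simp: vwalk_def partition_graph_def)
  then obtain q where q: "path_to n S (p ! i) q"
      "set_dist n S (p ! i) = ereal (real (vwalk_length q))"
    using shortest_path_exists S by blast
  then have q_walk: "vwalk q ?G" "hd q = p ! i" "last q \<in> S" "q \<noteq> []"
    by (auto simp: path_to_def vwalk_def)
  have prefix: "vwalk (take (Suc i) p) ?G"
    using walk(1) i vwalkI_append_l[of "take (Suc i) p" "drop (Suc i) p"] by auto
  have join: "joinable (take (Suc i) p) q"
    using q_walk i by (auto simp: joinable_def take_Suc_conv_app_nth)
  have detour: "path_to n S l (take (Suc i) p \<oplus> q)"
    unfolding path_to_def
    using vwalk_joinI_vwalk[OF prefix q_walk(1) join] walk(2) q_walk(3)
    by (simp add: vwalk_join_hd[OF join] vwalk_join_last[OF join])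
  have "set_dist n S l \<le> ereal (real (vwalk_length (take (Suc i) p \<oplus> q)))"
    by (rule set_dist_le[OF S(1) detour])
  also have "\<dots> = ereal (real i + real (vwalk_length q))"
    using i by (simp only: vwalk_join_vwalk_length[OF join]) simp
  finally show "ereal (real (vwalk_length p) - real i) \<le> set_dist n S (p ! i)"
    using p(2) q(2) by simp
qed

theorem proposition4p4:
  fixes n :: nat and S :: "nat list set" and l :: "nat list"
  assumes "n \<ge> 1"
    and "S \<subseteq> pverts (partition_graph n)" and "S \<noteq> {}"
    and "l \<in> pverts (partition_graph n)"
  shows "(\<exists>p. path_to n S l p \<and> monotone_inward n S p \<and>
              ereal (real (vwalk_length p)) = set_dist n S l) \<and>
         (\<exists>p. geodesic_to n S l p \<and> monotone_inward n S p)"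
proof -
  have S: "S \<subseteq> partitions n" and l: "l \<in> partitions n"
    using assms by (auto simp: partition_graph_def)
  obtain p where p: "path_to n S l p" "set_dist n S l = ereal (real (vwalk_length p))"
    using shortest_path_exists S assms(3) l by blast
  have "monotone_inward n S p"
    unfolding monotone_inward_def
  proof (intro conjI allI impI)
    show "vwalk p (with_proj (partition_graph n))"
      using p by (simp add: path_to_def)
    fix i assume "i < vwalk_length p"
    then have "i < length p" "Suc i < length p"
      by auto
    then show "set_dist n S (p ! Suc i) = set_dist n S (p ! i) - 1"
      using set_dist_along_shortest[OF S assms(3) p] by (simp add: one_ereal_def)
  qed
  moreover have "geodesic_to n S l p"
    unfolding geodesic_to_def using p set_dist_le[OF S] by fastforce
  ultimately show ?thesis
    using p by metis
qed

end
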